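(* Let $\mu^{TCDM}$ denote the final matching of the $T$-round time-constrained dynamic mechanism (TCDM) when all students follow straightforward strategies, and $\mu^{DA}$ the outcome of student-proposing deferred acceptance (DA) under truthful reports. Then: 1. TCDM need not be stable: there exist a college admissions problem with a common priority order and a number of rounds $T\geq 1$ for which $\mu^{TCDM}$ is not stable. 2. TCDM may be Pareto inefficient, and DA may Pareto dominate it: there exist such a problem and $T\ge 1$ for which $\mu^{DA}(i)\succeq_i\mu^{TCDM}(i)$ for every $i\in I$ and $\mu^{DA}(j)\succ_j\mu^{TCDM}(j)$ for some $j\in I$. 3. Moving from DA to TCDM may generate both winners and losers: there exist such a problem and $T\ge 1$ for which $\mu^{TCDM}(i)\succ_i\mu^{DA}(i)$ for some $i\in I$ and $\mu^{DA}(j)\succ_j\mu^{TCDM}(j)$ for some $j\in I$.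
   Context: Problem. $I$ is a finite set of students and $C$ a finite set of colleges. Each student $i$ has a strict preference (linear order) $\succ_i$ over $C\cup\{\emptyset\}$ with associated weak preference $\succeq_i$, where $\emptyset$ is the outside option (being unassigned); $c$ is acceptable to $i$ if $c\succ_i\emptyset$. Each college $c$ has capacity $q_c\in\mathbb{N}_+$. Each student has a score $s_i>0$, scores are distinct, and every college uses the common strict priority order $i\triangleright j\iff s_i>s_j$. Matching and stability. A matching is a map $\mu:I\to C\cup\{\emptyset\}$ with $|\mu^{-1}(c)|\le q_c$ for all $c$. Student $i$ blocks $\mu$ if $\emptyset\succ_i\mu(i)$. A pair $(i,c)$ blocks $\mu$ if $c\succ_i\mu(i)$ and either $|\mu^{-1}(c)|<q_c$ or there is $j\in\mu^{-1}(c)$ with $i\triangleright j$. $\mu$ is stable if no student and no pair blocks it. $\mu$ is Pareto efficient if there is no matching $\mu'$ with $\mu'(i)\succeq_i\mu(i)$ for all $i$ and $\mu'(j)\succ_j\mu(j)$ for some $j$. The cutoff of $c$ at $\mu$ is $f_c(\mu)=\min\{s_i:i\in\mu^{-1}(c)\}$ if $|\mu^{-1}(c)|=q_c$, and $f_c(\mu)=0$ otherwise. DA (student-proposing deferred acceptance). Step 1: each student applies to her most-preferred acceptable college (if any); each college tentatively holds its highest-priority applicants up to capacity and rejects the rest. Each later step: every student rejected in the preceding step applies to her next most-preferred acceptable college (if any); each college holds the highest-priority students up to capacity among those it was holding and its new applicants, and rejects the rest. It ends when no further rejection occurs; tentative acceptances become final and all other students are unassigned. TCDM. In each round $t=1,\dots,T$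 every student chooses one element of $C\cup\{\emptyset\}$ (replacing any earlier application). Given the current application profile, each college tentatively holds its highest-priority current applicants up to capacity and rejects the others; this defines the tentative matching $\mu^t$ (students who are rejected or chose $\emptyset$ are unassigned). The final matching is $\mu^T$. Straightforward strategy. In round 1 student $i$ applies to her $\succ_i$-best element of $C\cup\{\emptyset\}$. In round $t>1$: if $\mu^{t-1}(i)\in C$, she applies again to $\mu^{t-1}(i)$; if $\mu^{t-1}(i)=\emptyset$, she chooses her $\succ_i$-best element of $\{c\in C: s_i\ge f_c(\mu^{t-1})\}\cup\{\emptyset\}$. *)

theory Defs
  imports Complex_Main
begin

text \<open>
  The outside option \<open>\<emptyset>\<close> is \<open>None\<close> and college \<open>c\<close> is \<open>Some c\<close>. In \<open>pref P i\<close> the pair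
  \<open>(x, y)\<close> means that \<open>i\<close> strictly prefers \<open>x\<close> to \<open>y\<close>.
\<close>

record ('i, 'c) problem =
  students :: "'i set"
  colleges :: "'c set"
  pref :: "'i \<Rightarrow> ('c option \<times> 'c option) set"
  capacity :: "'c \<Rightarrow> nat"
  score :: "'i \<Rightarrow> real"

definition options :: "('i, 'c) problem \<Rightarrow> 'c option set" where
  "options P = insert None (Some ` colleges P)"

definition college_admissions_problem :: "('i, 'c) problem \<Rightarrow> bool" where
  "college_admissions_problem P \<longleftrightarrow>
     finite (students P) \<and> finite (colleges P) \<and>
     (\<forall>i\<in>students P. pref P i \<subseteq> options P \<times> options P \<and>
        strict_linear_order_on (options P) (pref P i)) \<and>
     (\<forall>c\<in>colleges P. capacity P c \<ge> 1) \<and>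
     (\<forall>i\<in>students P. score P i > 0) \<and>
     inj_on (score P) (students P)"

definition prefers :: "('i, 'c) problem \<Rightarrow> 'i \<Rightarrow> 'c option \<Rightarrow> 'c option \<Rightarrow> bool" where
  "prefers P i x y \<longleftrightarrow> (x, y) \<in> pref P i"

definition weakly_prefers :: "('i, 'c) problem \<Rightarrow> 'i \<Rightarrow> 'c option \<Rightarrow> 'c option \<Rightarrow> bool" where
  "weakly_prefers P i x y \<longleftrightarrow> prefers P i x y \<or> x = y"

definition acceptable :: "('i, 'c) problem \<Rightarrow> 'i \<Rightarrow> 'c \<Rightarrow> bool" where
  "acceptable P i c \<longleftrightarrow> prefers P i (Some c) None"

definition best :: "('i, 'c) problem \<Rightarrow> 'i \<Rightarrow> 'c option set \<Rightarrow> 'c option" where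
  "best P i A = (THE x. x \<in> A \<and> (\<forall>y\<in>A. weakly_prefers P i x y))"

definition higher_priority :: "('i, 'c) problem \<Rightarrow> 'i \<Rightarrow> 'i \<Rightarrow> bool" where
  "higher_priority P i j \<longleftrightarrow> score P i > score P j"

text \<open>
  A matching, like an application profile below, is a function on the whole type \<open>'i\<close>; only its
  values on \<open>students P\<close> matter.
\<close>

type_synonym ('i, 'c) assignment = "'i \<Rightarrow> 'c option"

definition assigned :: "('i, 'c) problem \<Rightarrow> ('i, 'c) assignment \<Rightarrow> 'c \<Rightarrow> 'i set" where
  "assigned P \<mu> c = {i \<in> students P. \<mu> i = Some c}"

definition matching :: "('i, 'c) problem \<Rightarrow> ('i, 'c) assignment \<Rightarrow> bool" where
  "matching P \<mu> \<longleftrightarrow>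
     (\<forall>i\<in>students P. \<mu> i \<in> options P) \<and>
     (\<forall>c\<in>colleges P. card (assigned P \<mu> c) \<le> capacity P c)"

definition student_blocks :: "('i, 'c) problem \<Rightarrow> ('i, 'c) assignment \<Rightarrow> 'i \<Rightarrow> bool" where
  "student_blocks P \<mu> i \<longleftrightarrow> prefers P i None (\<mu> i)"

definition pair_blocks :: "('i, 'c) problem \<Rightarrow> ('i, 'c) assignment \<Rightarrow> 'i \<Rightarrow> 'c \<Rightarrow> bool" where
  "pair_blocks P \<mu> i c \<longleftrightarrow>
     prefers P i (Some c) (\<mu> i) \<and>
     (card (assigned P \<mu> c) < capacity P c \<or> (\<exists>j\<in>assigned P \<mu> c. higher_priority P i j))"

definition stable_matching :: "('i, 'c) problem \<Rightarrow> ('i, 'c) assignment \<Rightarrow> bool" where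
  "stable_matching P \<mu> \<longleftrightarrow>
     \<not> (\<exists>i\<in>students P. student_blocks P \<mu> i) \<and>
     \<not> (\<exists>i\<in>students P. \<exists>c\<in>colleges P. pair_blocks P \<mu> i c)"

definition pareto_dominates ::
    "('i, 'c) problem \<Rightarrow> ('i, 'c) assignment \<Rightarrow> ('i, 'c) assignment \<Rightarrow> bool" where
  "pareto_dominates P \<mu>' \<mu> \<longleftrightarrow>
     (\<forall>i\<in>students P. weakly_prefers P i (\<mu>' i) (\<mu> i)) \<and>
     (\<exists>j\<in>students P. prefers P j (\<mu>' j) (\<mu> j))"

definition pareto_efficient :: "('i, 'c) problem \<Rightarrow> ('i, 'c) assignment \<Rightarrow> bool" where
  "pareto_efficient P \<mu> \<longleftrightarrow> \<not> (\<exists>\<mu>'. matching P \<mu>' \<and> pareto_dominates P \<mu>' \<mu>)"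

definition cutoff :: "('i, 'c) problem \<Rightarrow> ('i, 'c) assignment \<Rightarrow> 'c \<Rightarrow> real" where
  "cutoff P \<mu> c =
     (if card (assigned P \<mu> c) = capacity P c then Min (score P ` assigned P \<mu> c) else 0)"

text \<open>
  An applicant is among the top \<open>capacity P c\<close> members of the pool \<open>A\<close> iff fewer than
  \<open>capacity P c\<close> members of \<open>A\<close> have higher priority.
\<close>

definition held :: "('i, 'c) problem \<Rightarrow> 'c \<Rightarrow> 'i set \<Rightarrow> 'i set" where
  "held P c A = {i \<in> A. card {j \<in> A. higher_priority P j i} < capacity P c}"

definition tentative :: "('i, 'c) problem \<Rightarrow> ('i, 'c) assignment \<Rightarrow> ('i, 'c) assignment" where
  "tentative P a i =
     (case a i of None \<Rightarrow> None
      | Some c \<Rightarrow> if i \<in> held P c (assigned P a c) then Some c else None)"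

text \<open>
  A state \<open>(\<mu>, R)\<close> consists of the tentative matching \<open>\<mu>\<close> and, for each student, the set \<open>R i\<close> of
  colleges that \<open>i\<close> has applied to so far. A held student stays in the pool of the college holding
  her; any other student applies to her best acceptable college outside \<open>R i\<close>, if there is one.
\<close>

definition da_pool ::
    "('i, 'c) problem \<Rightarrow> ('i, 'c) assignment \<times> ('i \<Rightarrow> 'c set) \<Rightarrow> ('i, 'c) assignment" where
  "da_pool P S i =
     (case fst S i of Some c \<Rightarrow> Some c
      | None \<Rightarrow> let A = {c \<in> colleges P. acceptable P i c \<and> c \<notin> snd S i}
                in if A = {} then None else best P i (Some ` A))"

primrec da_state ::
    "('i, 'c) problem \<Rightarrow> nat \<Rightarrow> ('i, 'c) assignment \<times> ('i \<Rightarrow> 'c set)" where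
  "da_state P 0 = ((\<lambda>_. None), (\<lambda>_. {}))"
| "da_state P (Suc n) =
     (let a = da_pool P (da_state P n)
      in (tentative P a, (\<lambda>i. snd (da_state P n) i \<union> set_option (a i))))"

definition da_no_rejection :: "('i, 'c) problem \<Rightarrow> nat \<Rightarrow> bool" where
  "da_no_rejection P n \<longleftrightarrow>
     (\<forall>i\<in>students P. fst (da_state P (Suc n)) i = da_pool P (da_state P n) i)"

definition DA :: "('i, 'c) problem \<Rightarrow> ('i, 'c) assignment" where
  "DA P = fst (da_state P (Suc (LEAST n. da_no_rejection P n)))"

lemma best_in:
  assumes "college_admissions_problem P" "i \<in> students P" "A \<subseteq> options P" "A \<noteq> {}"
  shows "best P i A \<in> A"
proof -
  let ?r = "pref P i"
  have ord: "trans ?r" "irrefl ?r" "total_on (options P) ?r"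
    and fin: "finite (options P)"
    using assms(1,2)
    by (auto simp: college_admissions_problem_def strict_linear_order_on_def options_def)
  have "finite A" using fin assms(3) finite_subset by blast
  then have "\<exists>x\<in>A. \<forall>y\<in>A. weakly_prefers P i x y"
    using assms(3,4)
  proof (induction A rule: finite_induct)
    case (insert z F)
    show ?case
    proof (cases "F = {}")
      case True
      then show ?thesis by (auto simp: weakly_prefers_def)
    next
      case False
      then obtain x where x: "x \<in> F" "\<forall>y\<in>F. weakly_prefers P i x y"
        using insert by auto
      have "x = z \<or> (x, z) \<in> ?r \<or> (z, x) \<in> ?r"
        using ord(3) x(1) insert.prems unfolding total_on_def by blast
      then show ?thesis
      proof (elim disjE)
        assume "(z, x) \<in> ?r"
        then have "\<forall>y\<in>insert z F. weakly_prefers P i z y"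
          using x(2) ord(1) unfolding weakly_prefers_def prefers_def trans_def by blast
        then show ?thesis by blast
      qed (use x in \<open>auto simp: weakly_prefers_def prefers_def\<close>)
    qed
  qed simp
  then obtain x where x: "x \<in> A" "\<forall>y\<in>A. weakly_prefers P i x y"
    by blast
  moreover have "y = x" if "y \<in> A" "\<forall>z\<in>A. weakly_prefers P i y z" for y
    using that x ord(1,2) unfolding weakly_prefers_def prefers_def trans_def irrefl_def by blast
  ultimately show ?thesis
    unfolding best_def
    by (rule theI2[where P="\<lambda>x. x \<in> A \<and> (\<forall>y\<in>A. weakly_prefers P i x y)", OF conjI]) blast+
qed

text \<open>Deferred acceptance ends, so the \<open>LEAST\<close> in \<open>DA_def\<close> is attained.\<close>

lemma da_terminates:
  assumes P: "college_admissions_problem P"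
  shows "\<exists>n. da_no_rejection P n"
proof (rule ccontr)
  assume "\<nexists>n. da_no_rejection P n"
  then have rej: "\<exists>i\<in>students P. fst (da_state P (Suc n)) i \<noteq> da_pool P (da_state P n) i" for n
    unfolding da_no_rejection_def by blast
  define X where "X n = {(i, c). i \<in> students P \<and> c \<in> colleges P \<and>
      c \<in> snd (da_state P n) i \<and> fst (da_state P n) i \<noteq> Some c}" for n
  have fin: "finite (students P \<times> colleges P)"
    using P by (auto simp: college_admissions_problem_def)
  have pool: "c \<in> colleges P \<and> c \<notin> snd (da_state P n) i"
    if "i \<in> students P" "fst (da_state P n) i = None" "da_pool P (da_state P n) i = Some c" for n i c
  proof -
    let ?A = "{c \<in> colleges P. acceptable P i c \<and> c \<notin> snd (da_state P n) i}"
    have "?A \<noteq> {}" and b: "best P i (Some ` ?A) = Some c"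
      using that(2,3) by (auto simp: da_pool_def Let_def split: if_splits)
    then have "best P i (Some ` ?A) \<in> Some ` ?A"
      by (intro best_in[OF P that(1)]) (auto simp: options_def)
    then show ?thesis using b by auto
  qed
  have step: "fst (da_state P (Suc n)) i \<in> {None, da_pool P (da_state P n) i}"
    "snd (da_state P (Suc n)) i = snd (da_state P n) i \<union> set_option (da_pool P (da_state P n) i)" for n i
    by (auto simp: tentative_def Let_def split: option.splits)
  have held: "c \<in> colleges P \<and> c \<in> snd (da_state P n) i"
    if "i \<in> students P" "fst (da_state P n) i = Some c" for n i c
    using that(2)
  proof (induction n)
    case (Suc n)
    then have "da_pool P (da_state P n) i = Some c"
      using step(1)[of n i] by auto
    with Suc step(2)[of n i] pool[OF that(1), of n c] show ?case
      by (cases "fst (da_state P n) i") (auto simp: da_pool_def)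
  qed simp
  have grow: "X n \<subset> X (Suc n)" for n
  proof -
    obtain i where i: "i \<in> students P"
      and ne: "fst (da_state P (Suc n)) i \<noteq> da_pool P (da_state P n) i"
      using rej by blast
    then obtain c where c: "da_pool P (da_state P n) i = Some c" "fst (da_state P (Suc n)) i = None"
      using step(1)[of n i] by (cases "da_pool P (da_state P n) i") auto
    have "(i, c) \<in> X (Suc n) - X n"
    proof (cases "fst (da_state P n) i")
      case None
      then show ?thesis using pool[OF i None c(1)] i c step(2)[of n i] by (auto simp: X_def)
    next
      case (Some d)
      then have "d = c" using c(1) by (simp add: da_pool_def)
      then show ?thesis using held[OF i Some] Some i c step(2)[of n i] by (auto simp: X_def)
    qed
    moreover have "X n \<subseteq> X (Suc n)"
    proof (clarsimp simp: X_def simp del: da_state.simps)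
      fix j d
      assume j: "j \<in> students P" "d \<in> colleges P" "d \<in> snd (da_state P n) j"
        "fst (da_state P n) j \<noteq> Some d"
      have "da_pool P (da_state P n) j \<noteq> Some d"
        using pool[OF j(1), of n d] j(3,4)
        by (cases "fst (da_state P n) j") (force, simp add: da_pool_def)
      then show "d \<in> snd (da_state P (Suc n)) j \<and> fst (da_state P (Suc n)) j \<noteq> Some d"
        using step(1)[of n j] step(2)[of n j] j(3) by auto
    qed
    ultimately show ?thesis by blast
  qed
  have "X n \<subseteq> students P \<times> colleges P" for n by (auto simp: X_def)
  then have finX: "finite (X n)" and le: "card (X n) \<le> card (students P \<times> colleges P)" for n
    using fin by (auto intro: finite_subset card_mono)
  have "n \<le> card (X n)" for n
  proof (induction n)
    case (Suc n)
    then show ?case using psubset_card_mono[OF finX grow, of n] by simp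
  qed simp
  from this[of "Suc (card (students P \<times> colleges P))"] le show False
    by (meson not_less_eq_eq order_trans)
qed

text \<open>
  A history lists the tentative matchings of the completed rounds, the most recent one first;
  the strategy \<open>\<sigma> i\<close> of student \<open>i\<close> maps it to her application in the current round.
\<close>

primrec tcdm_history ::
    "('i, 'c) problem \<Rightarrow> ('i \<Rightarrow> ('i, 'c) assignment list \<Rightarrow> 'c option) \<Rightarrow> nat
      \<Rightarrow> ('i, 'c) assignment list" where
  "tcdm_history P \<sigma> 0 = []"
| "tcdm_history P \<sigma> (Suc t) =
     tentative P (\<lambda>i. \<sigma> i (tcdm_history P \<sigma> t)) # tcdm_history P \<sigma> t"

definition TCDM ::
    "('i, 'c) problem \<Rightarrow> ('i \<Rightarrow> ('i, 'c) assignment list \<Rightarrow> 'c option) \<Rightarrow> nat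
      \<Rightarrow> ('i, 'c) assignment" where
  "TCDM P \<sigma> T = hd (tcdm_history P \<sigma> T)"

definition straightforward ::
    "('i, 'c) problem \<Rightarrow> 'i \<Rightarrow> ('i, 'c) assignment list \<Rightarrow> 'c option" where
  "straightforward P i h =
     (case h of
        [] \<Rightarrow> best P i (options P)
      | \<mu> # _ \<Rightarrow>
          (case \<mu> i of
             Some c \<Rightarrow> Some c
           | None \<Rightarrow>
               best P i (insert None (Some ` {c \<in> colleges P. score P i \<ge> cutoff P \<mu> c}))))"

end

theory Submission
  imports Defs
begin

text \<open>
  One round suffices. Students \<open>0\<close> and \<open>1\<close> both start at college \<open>0\<close>, which rejects student \<open>1\<close>;
  TCDM stops there, whereas in DA student \<open>1\<close> moves on to college \<open>1\<close>. With only these two students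
  that move is a Pareto improvement. If a lower-priority student \<open>2\<close> likes college \<open>1\<close> best, DA
  gives her seat to student \<open>1\<close>, so she is the one who gains from stopping early.
\<close>

text \<open>Two top elements would be preferred to each other, which transitivity and irreflexivity
  exclude; hence exhibiting a top element evaluates the \<open>THE\<close> in
  \<open>best\<close>.\<close>

lemma best_eqI:
  assumes "college_admissions_problem P" "i \<in> students P"
    and "x \<in> A" "\<And>y. y \<in> A \<Longrightarrow> weakly_prefers P i x y"
  shows "best P i A = x"
proof -
  have "trans (pref P i)" "irrefl (pref P i)"
    using assms(1,2) by (auto simp: college_admissions_problem_def strict_linear_order_on_def)
  then have "y = x" if "y \<in> A" "\<forall>z\<in>A. weakly_prefers P i y z" for y
    using that assms(3,4) unfolding weakly_prefers_def prefers_def trans_def irrefl_def by blast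
  then show ?thesis
    unfolding best_def using assms(3,4) by (intro the_equality conjI ballI) blast+
qed

section \<open>The family of instances\<close>

text \<open>Instances of every size share one computation; \<open>n = 2\<close> and
  \<open>n = 3\<close> are the ones used in the end. The scores decrease in \<open>i\<close>, so a
  smaller index means higher priority. Students from 2 on find college 0 unacceptable, so a
  rejection at college 1 leaves them unassigned.\<close>

definition rejection_chain :: "nat \<Rightarrow> (nat, nat) problem" where
  "rejection_chain n = \<lparr>
     students = {..<n},
     colleges = {0, 1},
     pref = (\<lambda>i. if i < 2 then {(Some 0, Some 1), (Some 0, None), (Some 1, None)}
                 else {(Some 1, None), (Some 1, Some 0), (None, Some 0)}),
     capacity = (\<lambda>_. 1),
     score = (\<lambda>i. 1 / (real i + 1))\<rparr>"

lemma rejection_chain_sel [simp]: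
  "students (rejection_chain n) = {..<n}"
  "colleges (rejection_chain n) = {0, 1}"
  "capacity (rejection_chain n) c = 1"
  "options (rejection_chain n) = {None, Some 0, Some 1}"
  by (auto simp: rejection_chain_def options_def)

lemma prefers_rejection_chain [simp]:
  "prefers (rejection_chain n) i x y \<longleftrightarrow>
     (x, y) \<in> (if i < 2 then {(Some 0, Some 1), (Some 0, None), (Some 1, None)}
               else {(Some 1, None), (Some 1, Some 0), (None, Some 0)})"
  by (simp add: prefers_def rejection_chain_def)

lemma higher_priority_rejection_chain [simp]:
  "higher_priority (rejection_chain n) i j \<longleftrightarrow> i < j"
  by (simp add: higher_priority_def rejection_chain_def field_simps)

lemma college_admissions_problem_rejection_chain:
  "college_admissions_problem (rejection_chain n)"
  unfolding college_admissions_problem_def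
  by (auto simp: rejection_chain_def options_def strict_linear_order_on_def trans_def irrefl_def
      total_on_def inj_on_def)

lemmas best_rejection_chainI = best_eqI[OF college_admissions_problem_rejection_chain]

text \<open>With one seat, being held means that no smaller index applied to the same college, and
  \<open>j < i < n\<close> makes every such \<open>j\<close> a student. If
  \<open>a i = None\<close>, both branches give \<open>None\<close>.\<close>

lemma tentative_rejection_chain:
  assumes "i < n"
  shows "tentative (rejection_chain n) a i = (if \<exists>j<i. a j = a i then None else a i)"
proof (cases "a i")
  case (Some c)
  let ?A = "assigned (rejection_chain n) a c"
  \<comment> \<open>An infinite set would have \<open>card\<close> 0, so finiteness is what turns
    \<open>card < 1\<close> into emptiness.\<close>
  have "finite ?A" by (simp add: assigned_def)
  then have "i \<in> held (rejection_chain n) c ?A \<longleftrightarrow> {j \<in> ?A. j < i} = {}"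
    using Some assms by (auto simp: held_def assigned_def)
  also have "\<dots> \<longleftrightarrow> \<not> (\<exists>j<i. a j = a i)"
    using Some assms by (auto simp: assigned_def)
  finally show ?thesis using Some by (simp add: tentative_def)
qed (simp add: tentative_def)

section \<open>The run of deferred acceptance\<close>

lemma da_pool_rejection_chain:
  assumes "i < n"
  shows "da_pool (rejection_chain n) S i =
    (case fst S i of Some c \<Rightarrow> Some c
     | None \<Rightarrow> if i < 2 \<and> 0 \<notin> snd S i then Some 0
               else if 1 \<notin> snd S i then Some 1 else None)"
proof (cases "fst S i")
  case None
  define A where
    "A = {c \<in> colleges (rejection_chain n). acceptable (rejection_chain n) i c \<and> c \<notin> snd S i}"
  then have A: "A = (if i < 2 then {0, 1} else {1}) - snd S i"
    by (auto simp: acceptable_def)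
  have best: "best (rejection_chain n) i (Some ` A) =
      (if i < 2 \<and> 0 \<notin> snd S i then Some 0 else Some 1)" if "A \<noteq> {}"
    using assms that unfolding A
    by (intro best_rejection_chainI) (auto simp: weakly_prefers_def split: if_splits)
  have "A = {} \<longleftrightarrow> (i < 2 \<longrightarrow> 0 \<in> snd S i) \<and> 1 \<in> snd S i"
    unfolding A by auto
  moreover have "da_pool (rejection_chain n) S i =
      (if A = {} then None else best (rejection_chain n) i (Some ` A))"
    unfolding da_pool_def Let_def A_def None by simp
  ultimately show ?thesis
    using best None by (cases "A = {}") auto
qed (simp add: da_pool_def)

text \<open>Advances DA by one step from a closed form \<open>a\<close> of its pool. Knowing the
  pool below \<open>n\<close> is enough, since the competitors of \<open>i\<close> satisfy
  \<open>j < i < n\<close>.\<close>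

lemma da_state_rejection_chain_Suc:
  assumes "\<And>j. j < n \<Longrightarrow> da_pool (rejection_chain n) (da_state (rejection_chain n) m) j = a j"
    and "i < n"
  shows "fst (da_state (rejection_chain n) (Suc m)) i = (if \<exists>j<i. a j = a i then None else a i)"
    and "snd (da_state (rejection_chain n) (Suc m)) i =
      snd (da_state (rejection_chain n) m) i \<union> set_option (a i)"
proof -
  have "(\<exists>j<i. da_pool (rejection_chain n) (da_state (rejection_chain n) m) j = a i)
      \<longleftrightarrow> (\<exists>j<i. a j = a i)"
    using assms by (metis order_less_trans)
  then show "fst (da_state (rejection_chain n) (Suc m)) i =
      (if \<exists>j<i. a j = a i then None else a i)"
    by (simp only: da_state.simps(2) Let_def fst_conv tentative_rejection_chain[OF assms(2)]
        assms(1)[OF assms(2)])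
  show "snd (da_state (rejection_chain n) (Suc m)) i =
      snd (da_state (rejection_chain n) m) i \<union> set_option (a i)"
    by (simp only: da_state.simps(2) Let_def snd_conv assms(1)[OF assms(2)])
qed

text \<open>The first applications, common to DA and TCDM: student 0 beats student 1 at college 0,
  and student 2 beats all later ones at college 1.\<close>

lemma clash_first_choices:
  fixes i :: nat
  shows "(\<exists>j<i. (if j < 2 then Some 0 else Some 1) = (if i < 2 then Some 0 else Some (1::nat)))
    \<longleftrightarrow> i \<noteq> 0 \<and> i \<noteq> 2"
proof -
  consider "i = 0" | "i = 1" | "i = 2" | "2 < i" by arith
  then show ?thesis
  proof cases
    case 4
    then show ?thesis by (simp add: exI[of _ 2])
  qed simp_all
qed

lemma da_state_rejection_chain_1:
  assumes "i < n"
  shows "fst (da_state (rejection_chain n) 1) i =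
      (if i = 0 then Some 0 else if i = 2 then Some 1 else None)"
    and "snd (da_state (rejection_chain n) 1) i = (if i < 2 then {0} else {1})"
proof -
  have pool: "da_pool (rejection_chain n) (da_state (rejection_chain n) 0) j =
      (if j < 2 then Some 0 else Some 1)" if "j < n" for j
    using that by (simp add: da_pool_rejection_chain)
  show "fst (da_state (rejection_chain n) 1) i =
      (if i = 0 then Some 0 else if i = 2 then Some 1 else None)"
    using da_state_rejection_chain_Suc(1)[OF pool assms]
    unfolding clash_first_choices One_nat_def[symmetric] by simp
  show "snd (da_state (rejection_chain n) 1) i = (if i < 2 then {0} else {1})"
    using da_state_rejection_chain_Suc(2)[OF pool assms]
    unfolding One_nat_def[symmetric] by simp
qed

lemma da_state_rejection_chain_2:
  assumes "i < n"
  shows "fst (da_state (rejection_chain n) 2) i = (if i < 2 then Some i else None)"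
    and "snd (da_state (rejection_chain n) 2) i =
      (if i = 0 then {0} else if i = 1 then {0, 1} else {1})"
proof -
  \<comment> \<open>Student 1 moves on to college 1, while students after 2 have used up their only
    acceptable college.\<close>
  have pool: "da_pool (rejection_chain n) (da_state (rejection_chain n) 1) j =
      (if j < 2 then Some j else if j = 2 then Some 1 else None)" if "j < n" for j
    unfolding da_pool_rejection_chain[OF that] da_state_rejection_chain_1[OF that] by auto
  have two: "Suc 1 = (2::nat)" by simp
  \<comment> \<open>Student 2 now loses to student 1. The clashes for \<open>3 < i\<close> are
    spurious, \<open>None\<close> meeting the \<open>None\<close> of student 3, and harmless because
    the result is \<open>None\<close> anyway.\<close>
  have clash: "(\<exists>j<i. (if j < 2 then Some j else if j = 2 then Some 1 else None) =
      (if i < 2 then Some i else if i = 2 then Some 1 else None)) \<longleftrightarrow> i = 2 \<or> 3 < i"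
  proof -
    consider "i = 0" | "i = 1" | "i = 2" | "i = 3" | "3 < i" by arith
    then show ?thesis
    proof cases
      case 3
      then show ?thesis by (simp add: exI[of _ 1])
    next
      case 5
      then show ?thesis by (simp add: exI[of _ 3])
    qed simp_all
  qed
  show "fst (da_state (rejection_chain n) 2) i = (if i < 2 then Some i else None)"
    using da_state_rejection_chain_Suc(1)[OF pool assms] unfolding two clash by simp
  show "snd (da_state (rejection_chain n) 2) i =
      (if i = 0 then {0} else if i = 1 then {0, 1} else {1})"
    using da_state_rejection_chain_Suc(2)[OF pool assms]
    unfolding two da_state_rejection_chain_1[OF assms] by auto
qed

text \<open>Student 2, rejected in the second step, has no acceptable college left, so the third
  step brings no new application.\<close>

lemma da_pool_rejection_chain_2:
  assumes "i < n"
  shows "da_pool (rejection_chain n) (da_state (rejection_chain n) 2) i =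
    (if i < 2 then Some i else None)"
  unfolding da_pool_rejection_chain[OF assms] da_state_rejection_chain_2[OF assms] by auto

lemma da_state_rejection_chain_3:
  assumes "i < n"
  shows "fst (da_state (rejection_chain n) 3) i = (if i < 2 then Some i else None)"
proof -
  have three: "Suc 2 = (3::nat)" by simp
  show ?thesis
    using da_state_rejection_chain_Suc(1)[OF da_pool_rejection_chain_2 assms]
    unfolding three by (auto split: if_splits)
qed

lemma DA_rejection_chain:
  assumes "2 \<le> n" "i < n"
  shows "DA (rejection_chain n) i = (if i < 2 then Some i else None)"
proof -
  let ?stop = "da_no_rejection (rejection_chain n)"
  have numerals: "Suc 0 = 1" "Suc 1 = (2::nat)" "Suc 2 = (3::nat)" by simp_all
  have "1 < n" using assms(1) by simp
  \<comment> \<open>\<open>?stop m\<close> speaks of step \<open>m + 1\<close>; it fails at 0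
    because college 0 rejects student 1.\<close>
  then have "da_pool (rejection_chain n) (da_state (rejection_chain n) 0) 1 = Some 0"
    "fst (da_state (rejection_chain n) 1) 1 = None"
    using da_state_rejection_chain_1(1)[of 1 n] by (simp_all add: da_pool_rejection_chain)
  with \<open>1 < n\<close> have "\<not> ?stop 0"
    unfolding da_no_rejection_def numerals rejection_chain_sel
    by (metis lessThan_iff option.distinct(1))
  moreover have stop: "?stop 2"
    unfolding da_no_rejection_def numerals
    by (simp add: da_state_rejection_chain_3 da_pool_rejection_chain_2)
  moreover have "(LEAST m. ?stop m) \<le> 2"
    using stop by (rule Least_le)
  moreover have "?stop (LEAST m. ?stop m)"
    using stop by (rule LeastI)
  ultimately have "(LEAST m. ?stop m) \<noteq> 0" "(LEAST m. ?stop m) \<le> 2"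
    by metis+
  \<comment> \<open>The least index is 1 if \<open>n = 2\<close>, and 2 if student 2 is there to be
    rejected. Both give the same outcome, as the matchings after two and three steps agree on all
    students.\<close>
  then have "(LEAST m. ?stop m) = 1 \<or> (LEAST m. ?stop m) = 2"
    by arith
  then show ?thesis
    unfolding DA_def using da_state_rejection_chain_2(1)[OF assms(2)]
      da_state_rejection_chain_3[OF assms(2)] numerals by metis
qed

section \<open>One round of TCDM and its comparison with DA\<close>

text \<open>Round 1 starts from the empty history, so each student applies to her favourite option,
  exactly as in the first step of DA.\<close>

lemma TCDM_rejection_chain:
  assumes "i < n"
  shows "TCDM (rejection_chain n) (straightforward (rejection_chain n)) 1 i =
    (if i = 0 then Some 0 else if i = 2 then Some 1 else None)"
proof -
  have top: "straightforward (rejection_chain n) j [] = (if j < 2 then Some 0 else Some 1)"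
    if "j < n" for j
    using that unfolding straightforward_def list.case
    by (intro best_rejection_chainI) (auto simp: weakly_prefers_def)
  have clash: "(\<exists>j<i. straightforward (rejection_chain n) j [] = straightforward (rejection_chain n) i [])
      \<longleftrightarrow> i \<noteq> 0 \<and> i \<noteq> 2"
    unfolding clash_first_choices[symmetric]
    by (intro ex_cong1 conj_cong refl) (use assms in \<open>simp add: top\<close>)
  have "TCDM (rejection_chain n) (straightforward (rejection_chain n)) 1 i =
      (if i \<noteq> 0 \<and> i \<noteq> 2 then None else straightforward (rejection_chain n) i [])"
    by (simp only: TCDM_def One_nat_def tcdm_history.simps list.sel
        tentative_rejection_chain[OF assms] clash)
  then show ?thesis
    unfolding top[OF assms] by simp
qed

text \<open>Pareto inefficiency asks for a dominating matching, so the DA outcome must be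
  feasible.\<close>

lemma matching_DA_rejection_chain:
  assumes "2 \<le> n"
  shows "matching (rejection_chain n) (DA (rejection_chain n))"
proof -
  \<comment> \<open>Under DA only student \<open>c\<close> can hold college
    \<open>c\<close>.\<close>
  have "assigned (rejection_chain n) (DA (rejection_chain n)) c \<subseteq> {c}" for c
    using DA_rejection_chain[OF assms] by (auto simp: assigned_def split: if_splits)
  then have "card (assigned (rejection_chain n) (DA (rejection_chain n)) c) \<le> 1" for c
    using card_mono[of "{c}"] by fastforce
  then show ?thesis
    using DA_rejection_chain[OF assms] by (auto simp: matching_def)
qed

theorem mainTheorem6:
  shows "(\<exists>(P :: (nat, nat) problem) T.
            college_admissions_problem P \<and> T \<ge> 1 \<and>
            \<not> stable_matching P (TCDM P (straightforward P) T))
       \<and> (\<exists>(P :: (nat, nat) problem) T.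
            college_admissions_problem P \<and> T \<ge> 1 \<and>
            \<not> pareto_efficient P (TCDM P (straightforward P) T) \<and>
            pareto_dominates P (DA P) (TCDM P (straightforward P) T))
       \<and> (\<exists>(P :: (nat, nat) problem) T.
            college_admissions_problem P \<and> T \<ge> 1 \<and>
            (\<exists>i\<in>students P. prefers P i (TCDM P (straightforward P) T i) (DA P i)) \<and>
            (\<exists>j\<in>students P. prefers P j (DA P j) (TCDM P (straightforward P) T j)))"
proof (intro conjI)
  let ?TCDM = "\<lambda>n. TCDM (rejection_chain n) (straightforward (rejection_chain n)) 1"
  note cap = college_admissions_problem_rejection_chain
  \<comment> \<open>Keeps the simplifier from turning the round count \<open>1\<close> into
    \<open>Suc 0\<close>, which \<open>TCDM_rejection_chain\<close> would not match.\<close>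
  note One_nat_def [simp del]
  note outcomes = DA_rejection_chain TCDM_rejection_chain
  \<comment> \<open>Without student 2 nobody applies to college 1 in round 1; its free seat lets
    student 1 block.\<close>
  have "assigned (rejection_chain 2) (?TCDM 2) 1 = {}"
    by (auto simp: assigned_def TCDM_rejection_chain)
  then have "pair_blocks (rejection_chain 2) (?TCDM 2) 1 1"
    by (simp add: pair_blocks_def TCDM_rejection_chain)
  then have "\<not> stable_matching (rejection_chain 2) (?TCDM 2)"
    by (auto simp: stable_matching_def)
  then show "\<exists>(P :: (nat, nat) problem) T. college_admissions_problem P \<and> T \<ge> 1 \<and>
      \<not> stable_matching P (TCDM P (straightforward P) T)"
    using cap by blast
  \<comment> \<open>Student 0 gets college 0 either way; student 1 gains college 1.\<close>
  have "pareto_dominates (rejection_chain 2) (DA (rejection_chain 2)) (?TCDM 2)"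
    by (auto simp: pareto_dominates_def weakly_prefers_def outcomes intro!: bexI[of _ 1])
  moreover from this have "\<not> pareto_efficient (rejection_chain 2) (?TCDM 2)"
    using matching_DA_rejection_chain[of 2] by (auto simp: pareto_efficient_def)
  ultimately show "\<exists>(P :: (nat, nat) problem) T. college_admissions_problem P \<and> T \<ge> 1 \<and>
      \<not> pareto_efficient P (TCDM P (straightforward P) T) \<and>
      pareto_dominates P (DA P) (TCDM P (straightforward P) T)"
    using cap by blast
  \<comment> \<open>Ending after one round leaves student 2 the seat that DA hands to student
    1.\<close>
  have "prefers (rejection_chain 3) 2 (?TCDM 3 2) (DA (rejection_chain 3) 2)"
    "prefers (rejection_chain 3) 1 (DA (rejection_chain 3) 1) (?TCDM 3 1)"
    by (simp_all add: outcomes)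
  moreover have "2 \<in> students (rejection_chain 3)" "1 \<in> students (rejection_chain 3)"
    by simp_all
  ultimately show "\<exists>(P :: (nat, nat) problem) T. college_admissions_problem P \<and> T \<ge> 1 \<and>
      (\<exists>i\<in>students P. prefers P i (TCDM P (straightforward P) T i) (DA P i)) \<and>
      (\<exists>j\<in>students P. prefers P j (DA P j) (TCDM P (straightforward P) T j))"
    using cap by blast
qed

end
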